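(* If $\Omega$ is a bounded domain in $\mathbb{C}^n$ and $\mathcal{S}_1$ and $\mathcal{S}_2$ are isometrically isomorphic submodules of $L^2_a(\Omega)$, then $\mathcal{S}_1=\mathcal{S}_2$.
   Context: $A(\Omega)$ is the uniform closure, in the continuous functions on $\overline{\Omega}$, of the functions holomorphic in a neighborhood of $\overline{\Omega}$. $L^2_a(\Omega)$ is the Bergman module: the Hilbert space of holomorphic functions on $\Omega$ that are square integrable with respect to volume measure, with $A(\Omega)$ acting by pointwise multiplication. A submodule is a closed subspace invariant under this action. Two submodules are isometrically isomorphic if there is a surjective isometric linear map between them that commutes with the module action. *)

theory Defs
  imports "HOL-Analysis.Analysis"
begin

text \<open>
  Points of $\mathbb{C}^n$ are vectors of type \<open>complex ^ 'n\<close>, and \<open>lborel\<close> on this type is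
  $2n$-dimensional Lebesgue measure.  The elements of the two function spaces below, which are
  functions on $\overline\Omega$ and on $\Omega$ respectively, are represented by total functions
  vanishing outside that set, so that HOL equality is equality of functions on it.
\<close>

text \<open>
  Holomorphy on an open set: the (real) Frechet derivative exists at every point and is
  complex linear; \<open>*s\<close> is multiplication of a vector by a complex scalar.
\<close>

definition cn_holomorphic_on :: "(complex ^ 'n \<Rightarrow> complex) \<Rightarrow> (complex ^ 'n) set \<Rightarrow> bool"
    (infix "cn'_holomorphic'_on" 50) where
  "f cn_holomorphic_on U \<longleftrightarrow>
     (\<forall>z\<in>U. \<exists>D. (f has_derivative D) (at z) \<and> (\<forall>c v. D (c *s v) = c * D v))"

definition domain_algebra :: "(complex ^ 'n) set \<Rightarrow> (complex ^ 'n \<Rightarrow> complex) set" where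
  "domain_algebra \<Omega> = {\<phi>. continuous_on (closure \<Omega>) \<phi> \<and> (\<forall>z. z \<notin> closure \<Omega> \<longrightarrow> \<phi> z = 0) \<and>
     (\<exists>h. (\<forall>k. \<exists>U. open U \<and> closure \<Omega> \<subseteq> U \<and> h k cn_holomorphic_on U) \<and>
          uniform_limit (closure \<Omega>) h \<phi> sequentially)}"

definition bergman_space :: "(complex ^ 'n) set \<Rightarrow> (complex ^ 'n \<Rightarrow> complex) set" where
  "bergman_space \<Omega> = {f. f cn_holomorphic_on \<Omega> \<and> (\<forall>z. z \<notin> \<Omega> \<longrightarrow> f z = 0) \<and>
     set_integrable lborel \<Omega> (\<lambda>z. (cmod (f z))\<^sup>2)}"

definition bergman_norm :: "(complex ^ 'n) set \<Rightarrow> (complex ^ 'n \<Rightarrow> complex) \<Rightarrow> real" where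
  "bergman_norm \<Omega> f = sqrt (LINT z:\<Omega>|lborel. (cmod (f z))\<^sup>2)"

text \<open>
  The fifth conjunct is closedness in the norm of the Bergman space, stated with sequences; the
  topology that \<open>closed\<close> would refer to on the function type is that of pointwise convergence.
\<close>

definition bergman_submodule ::
    "(complex ^ 'n) set \<Rightarrow> (complex ^ 'n \<Rightarrow> complex) set \<Rightarrow> bool" where
  "bergman_submodule \<Omega> S \<longleftrightarrow>
     S \<subseteq> bergman_space \<Omega> \<and>
     (\<lambda>z. 0) \<in> S \<and>
     (\<forall>f\<in>S. \<forall>g\<in>S. (\<lambda>z. f z + g z) \<in> S) \<and>
     (\<forall>c. \<forall>f\<in>S. (\<lambda>z. c * f z) \<in> S) \<and>
     (\<forall>F. \<forall>f\<in>bergman_space \<Omega>. (\<forall>k::nat. F k \<in> S) \<longrightarrow>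
        (\<lambda>k. bergman_norm \<Omega> (\<lambda>z. F k z - f z)) \<longlonglongrightarrow> 0 \<longrightarrow> f \<in> S) \<and>
     (\<forall>\<phi>\<in>domain_algebra \<Omega>. \<forall>f\<in>S. (\<lambda>z. \<phi> z * f z) \<in> S)"

definition isometrically_isomorphic ::
    "(complex ^ 'n) set \<Rightarrow> (complex ^ 'n \<Rightarrow> complex) set \<Rightarrow> (complex ^ 'n \<Rightarrow> complex) set \<Rightarrow> bool"
  where
  "isometrically_isomorphic \<Omega> S1 S2 \<longleftrightarrow>
     (\<exists>T. T ` S1 = S2 \<and>
        (\<forall>f\<in>S1. \<forall>g\<in>S1. T (\<lambda>z. f z + g z) = (\<lambda>z. T f z + T g z)) \<and>
        (\<forall>c. \<forall>f\<in>S1. T (\<lambda>z. c * f z) = (\<lambda>z. c * T f z)) \<and>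
        (\<forall>f\<in>S1. bergman_norm \<Omega> (T f) = bergman_norm \<Omega> f) \<and>
        (\<forall>\<phi>\<in>domain_algebra \<Omega>. \<forall>f\<in>S1. T (\<lambda>z. \<phi> z * f z) = (\<lambda>z. \<phi> z * T f z)))"

end

theory Submission
  imports Defs "HOL-Complex_Analysis.Conformal_Mappings"
begin

text \<open>
  Let \<open>T\<close> be an isometric module map and \<open>f \<in> S1\<close>.  For every entire \<open>\<phi>\<close> the functions
  \<open>\<phi> f\<close> and \<open>T (\<phi> f) = \<phi> T f\<close> have the same norm, so \<open>|\<phi>|\<^sup>2\<close> integrates to zero against
  \<open>|f|\<^sup>2 - |T f|\<^sup>2\<close>.  By polarization the same holds for all products of a holomorphic and an
  antiholomorphic function, whose sums contain the real polynomials; by Stone-Weierstrass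
  \<open>|f| = |T f|\<close> on \<open>\<Omega>\<close>.  Two holomorphic functions of equal modulus on a domain differ by a
  unimodular constant, so \<open>T f\<close> is a scalar multiple of \<open>f\<close>.
\<close>

section \<open>Holomorphic functions of several variables\<close>

lemma bounded_linear_vector_smult_left: "bounded_linear (\<lambda>t. t *s d)"
  for d :: "complex ^ 'n"
  by (auto intro!: linear_conv_bounded_linear[THEN iffD1] linearI simp: vec_eq_iff algebra_simps)

lemma bounded_linear_vector_smult_right: "bounded_linear (\<lambda>v. c *s v)"
  for c :: complex and v :: "complex ^ 'n"
  by (auto intro!: linear_conv_bounded_linear[THEN iffD1] linearI simp: vec_eq_iff algebra_simps)

lemma cn_holomorphic_on_subset:
  "f cn_holomorphic_on U \<Longrightarrow> V \<subseteq> U \<Longrightarrow> f cn_holomorphic_on V"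
  unfolding cn_holomorphic_on_def by blast

lemma cn_holomorphic_on_const: "(\<lambda>z. c) cn_holomorphic_on U"
  unfolding cn_holomorphic_on_def by (auto intro!: exI[of _ "\<lambda>v. 0"])

lemma cn_holomorphic_on_linear:
  assumes "bounded_linear L" and "\<And>c v. L (c *s v) = c * L v"
  shows "L cn_holomorphic_on U"
  unfolding cn_holomorphic_on_def
  using assms bounded_linear_imp_has_derivative by blast

lemma cn_holomorphic_on_add:
  assumes "f cn_holomorphic_on U" and "g cn_holomorphic_on U"
  shows "(\<lambda>z. f z + g z) cn_holomorphic_on U"
  unfolding cn_holomorphic_on_def
proof
  fix z assume "z \<in> U"
  with assms obtain D E where
    "(f has_derivative D) (at z)" "\<forall>c v. D (c *s v) = c * D v"
    "(g has_derivative E) (at z)" "\<forall>c v. E (c *s v) = c * E v"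
    unfolding cn_holomorphic_on_def by meson
  then show "\<exists>D. ((\<lambda>z. f z + g z) has_derivative D) (at z) \<and> (\<forall>c v. D (c *s v) = c * D v)"
    by (intro exI[of _ "\<lambda>v. D v + E v"]) (auto intro!: has_derivative_add simp: algebra_simps)
qed

lemma cn_holomorphic_on_mult:
  assumes "f cn_holomorphic_on U" and "g cn_holomorphic_on U"
  shows "(\<lambda>z. f z * g z) cn_holomorphic_on U"
  unfolding cn_holomorphic_on_def
proof
  fix z assume "z \<in> U"
  with assms obtain D E where
    "(f has_derivative D) (at z)" "\<forall>c v. D (c *s v) = c * D v"
    "(g has_derivative E) (at z)" "\<forall>c v. E (c *s v) = c * E v"
    unfolding cn_holomorphic_on_def by meson
  then show "\<exists>D. ((\<lambda>z. f z * g z) has_derivative D) (at z) \<and> (\<forall>c v. D (c *s v) = c * D v)"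
    by (intro exI[of _ "\<lambda>v. f z * E v + D v * g z"] conjI has_derivative_mult)
      (simp_all add: algebra_simps)
qed

lemma cn_holomorphic_on_imp_continuous_on:
  assumes "f cn_holomorphic_on U" shows "continuous_on U f"
  using assms unfolding cn_holomorphic_on_def
  by (meson continuous_at_imp_continuous_on has_derivative_continuous)

section \<open>Restriction to complex lines and the identity theorem\<close>

lemma cn_holomorphic_on_line:
  assumes "f cn_holomorphic_on U"
  shows "(\<lambda>t. f (p + t *s d)) holomorphic_on {t. p + t *s d \<in> U}"
proof (rule holomorphic_onI)
  fix t assume "t \<in> {t. p + t *s d \<in> U}"
  then obtain D where D: "(f has_derivative D) (at (p + t *s d))" "\<And>c v. D (c *s v) = c * D v"
    using assms unfolding cn_holomorphic_on_def by blast
  have "((\<lambda>t. p + t *s d) has_derivative (\<lambda>t. t *s d)) (at t)"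
    using has_derivative_add[OF has_derivative_const
        bounded_linear_imp_has_derivative[OF bounded_linear_vector_smult_left]] by simp
  from has_derivative_compose[OF this D(1)]
  \<comment> \<open>Complex linearity of \<open>D\<close> makes the real derivative along the line a
    multiplication by the complex number \<open>D d\<close>, so that one-variable theory
    applies.\<close>
  moreover have "(\<lambda>t. D (t *s d)) = (*) (D d)"
    by (simp add: D(2) fun_eq_iff mult.commute)
  ultimately have "((\<lambda>t. f (p + t *s d)) has_field_derivative D d) (at t)"
    by (simp add: has_field_derivative_def)
  then show "(\<lambda>t. f (p + t *s d)) field_differentiable at t within {t. p + t *s d \<in> U}"
    using field_differentiable_at_within field_differentiable_def by blast
qed

lemma convex_line_preimage:
  fixes p d :: "complex ^ 'n"
  assumes "convex U" shows "convex {t. p + t *s d \<in> U}"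
proof (rule convexI)
  fix x y :: complex and u v :: real
  assume *: "x \<in> {t. p + t *s d \<in> U}" "y \<in> {t. p + t *s d \<in> U}" "0 \<le> u" "0 \<le> v" "u + v = 1"
  have "u *\<^sub>R (p + x *s d) + v *\<^sub>R (p + y *s d) = (u + v) *\<^sub>R p + (u *\<^sub>R x + v *\<^sub>R y) *s d"
    by (simp add: vec_eq_iff algebra_simps)
  moreover have "u *\<^sub>R (p + x *s d) + v *\<^sub>R (p + y *s d) \<in> U"
    using * assms by (auto simp: convex_def)
  ultimately show "u *\<^sub>R x + v *\<^sub>R y \<in> {t. p + t *s d \<in> U}"
    using \<open>u + v = 1\<close> by simp
qed

lemma open_line_preimage:
  fixes p d :: "complex ^ 'n"
  assumes "open U" shows "open {t. p + t *s d \<in> U}"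
proof -
  have "continuous_on UNIV (\<lambda>t. p + t *s d)"
    by (intro continuous_intros linear_continuous_on bounded_linear_vector_smult_left)
  from open_vimage[OF assms this] show ?thesis by (simp add: vimage_def)
qed

text \<open>The complex line through \<open>p\<close> and \<open>q\<close> reduces the claim to one
  variable: the restriction of \<open>h\<close> vanishes near parameter 0, hence also at parameter
  1, because convexity of \<open>U\<close> makes the set of admissible parameters connected.\<close>

lemma cn_holomorphic_zero_on_convex:
  assumes "h cn_holomorphic_on U" and "open U" and "convex U"
    and "open V" and "p \<in> V" and "V \<subseteq> U" and "\<And>z. z \<in> V \<Longrightarrow> h z = 0" and "q \<in> U"
  shows "h q = 0"
proof -
  define d where "d = q - p"
  define T where "T W = {t. p + t *s d \<in> W}" for W
  have q: "p + d = q" by (simp add: d_def)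
  have "open (T V)" "0 \<in> T V"
    using assms by (auto simp: T_def open_line_preimage)
  then have "0 islimpt T V"
    by (simp add: interior_limit_point interior_open)
  moreover have "(\<lambda>t. h (p + t *s d)) holomorphic_on T U"
    unfolding T_def by (rule cn_holomorphic_on_line[OF assms(1)])
  moreover have "open (T U)" "connected (T U)"
    unfolding T_def using assms(2,3)
    by (auto intro: open_line_preimage convex_connected convex_line_preimage)
  moreover have "T V \<subseteq> T U" "0 \<in> T U" "1 \<in> T U"
    unfolding T_def using assms(5,6,8) q by auto
  moreover have "h (p + t *s d) = 0" if "t \<in> T V" for t
    using that assms(7) unfolding T_def by blast
  ultimately have "h (p + 1 *s d) = 0"
    using analytic_continuation[of "\<lambda>t. h (p + t *s d)" "T U" "T V" 0 1] by blast
  then show ?thesis by (simp add: q)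
qed

text \<open>The interior of the zero set has an open complement in \<Omega>: by the convex case, a
  ball in \<Omega> that meets this interior lies inside it. Connectedness and the nonempty
  \<open>V\<close> then leave nothing in the complement.\<close>

lemma cn_holomorphic_identity_theorem:
  assumes h: "h cn_holomorphic_on \<Omega>" and "open \<Omega>" and "connected \<Omega>"
    and V: "open V" "V \<noteq> {}" "V \<subseteq> \<Omega>" "\<And>z. z \<in> V \<Longrightarrow> h z = 0" and "q \<in> \<Omega>"
  shows "h q = 0"
proof -
  define A where "A = interior {z \<in> \<Omega>. h z = 0}"
  have A: "open A" "A \<subseteq> \<Omega>" "\<And>z. z \<in> A \<Longrightarrow> h z = 0"
    unfolding A_def using interior_subset by auto
  have "\<exists>e>0. ball z e \<subseteq> \<Omega> - A" if z: "z \<in> \<Omega> - A" for z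
  proof -
    obtain e where e: "e > 0" "ball z e \<subseteq> \<Omega>"
      using \<open>open \<Omega>\<close> z open_contains_ball by blast
    have "ball z e \<inter> A = {}"
    proof (rule ccontr)
      assume "ball z e \<inter> A \<noteq> {}"
      then obtain p where "p \<in> ball z e \<inter> A" by blast
      then have "h w = 0" if "w \<in> ball z e" for w
        using cn_holomorphic_zero_on_convex[of h "ball z e" "ball z e \<inter> A" p w] that A
          cn_holomorphic_on_subset[OF h e(2)] open_Int[OF open_ball A(1)]
          open_ball convex_ball by blast
      then have "ball z e \<subseteq> A"
        unfolding A_def using e by (intro interior_maximal) auto
      then show False using z e(1) centre_in_ball by blast
    qed
    then show ?thesis using e by blast
  qed
  then have "open (\<Omega> - A)"
    by (simp add: open_contains_ball)
  moreover have "V \<subseteq> A"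
    unfolding A_def using V by (intro interior_maximal) auto
  ultimately have "(\<Omega> - A) \<inter> \<Omega> = {}"
    using connectedD[OF \<open>connected \<Omega>\<close> \<open>open A\<close>, of "\<Omega> - A"] V A(2) by blast
  then show ?thesis using \<open>q \<in> \<Omega>\<close> A(3) by blast
qed

section \<open>Holomorphic functions of equal modulus\<close>

lemma cn_holomorphic_equal_norm_imp_proportional_on_convex:
  assumes f: "f cn_holomorphic_on U" and g: "g cn_holomorphic_on U" and "open U" and "convex U"
    and eq: "\<And>z. z \<in> U \<Longrightarrow> cmod (g z) = cmod (f z)" and nz: "\<And>z. z \<in> U \<Longrightarrow> f z \<noteq> 0"
    and "p \<in> U" and "q \<in> U"
  shows "g q / f q = g p / f p"
proof -
  define d where "d = q - p"
  define T where "T = {t. p + t *s d \<in> U}"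
  define u where "u = (\<lambda>t. g (p + t *s d) / f (p + t *s d))"
  have q: "p + d = q" by (simp add: d_def)
  have T: "open T" "connected T" "0 \<in> T" "1 \<in> T"
    using assms q by (auto simp: T_def open_line_preimage convex_line_preimage convex_connected)
  have "u holomorphic_on T"
    unfolding u_def T_def using nz
    by (intro holomorphic_on_divide cn_holomorphic_on_line f g) auto
  \<comment> \<open>The quotient has constant modulus on the slice through \<open>p\<close> and
    \<open>q\<close>, so its modulus is maximal at the interior point 0 and the maximum modulus
    principle makes \<open>u\<close> constant.\<close>
  moreover have "cmod (u t) = 1" if "t \<in> T" for t
    using that eq nz by (simp add: u_def T_def norm_divide)
  ultimately have "u constant_on T"
    using T by (intro maximum_modulus_principle[where U = T and \<xi> = 0]) auto
  then have "u 1 = u 0"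
    using T unfolding constant_on_def by metis
  then show ?thesis by (simp add: u_def q)
qed

text \<open>On a ball free of zeros of \<open>f\<close> the quotient is a constant \<open>c\<close>.
  The identity theorem for \<open>g - c f\<close> carries the relation to all of \<Omega>, across
  the zeros of \<open>f\<close>.\<close>

lemma cn_holomorphic_equal_norm_imp_proportional:
  assumes f: "f cn_holomorphic_on \<Omega>" and g: "g cn_holomorphic_on \<Omega>"
    and "open \<Omega>" and "connected \<Omega>" and eq: "\<And>z. z \<in> \<Omega> \<Longrightarrow> cmod (g z) = cmod (f z)"
  obtains c where "cmod c = 1" and "\<And>z. z \<in> \<Omega> \<Longrightarrow> g z = c * f z"
proof (cases "\<forall>z\<in>\<Omega>. f z = 0")
  case True
  \<comment> \<open>Here \<open>g\<close> vanishes on \<Omega> as well, so any unimodular constant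
    would serve.\<close>
  then show ?thesis using eq by (intro that[of 1]) auto
next
  case False
  then obtain p where p: "p \<in> \<Omega>" "f p \<noteq> 0" by blast
  have "open {z \<in> \<Omega>. f z \<noteq> 0}"
    using continuous_open_preimage[OF cn_holomorphic_on_imp_continuous_on[OF f] \<open>open \<Omega>\<close>, of "-{0}"]
    by (simp add: vimage_def Int_def open_Compl)
  with p obtain e where e: "e > 0" "ball p e \<subseteq> {z \<in> \<Omega>. f z \<noteq> 0}"
    unfolding open_contains_ball by blast
  define c where "c = g p / f p"
  have "g z / f z = c" if "z \<in> ball p e" for z
    unfolding c_def using e that eq
    by (intro cn_holomorphic_equal_norm_imp_proportional_on_convex[where U = "ball p e"]
        cn_holomorphic_on_subset[OF f] cn_holomorphic_on_subset[OF g]) auto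
  then have "g z + (- c) * f z = 0" if "z \<in> ball p e" for z
    using e(2) that by (force simp: divide_eq_eq)
  moreover have "(\<lambda>z. g z + (- c) * f z) cn_holomorphic_on \<Omega>"
    by (intro cn_holomorphic_on_add cn_holomorphic_on_mult cn_holomorphic_on_const f g)
  moreover have "ball p e \<noteq> {}" "ball p e \<subseteq> \<Omega>" using e by auto
  ultimately have "g z + (- c) * f z = 0" if "z \<in> \<Omega>" for z
    using cn_holomorphic_identity_theorem[of "\<lambda>z. g z + (- c) * f z" \<Omega> "ball p e" z]
      that assms(3,4) open_ball by blast
  moreover have "cmod c = 1"
    using p eq by (simp add: c_def norm_divide)
  ultimately show ?thesis by (intro that[of c]) (auto simp: algebra_simps)
qed

section \<open>Density of the products of holomorphic and antiholomorphic functions\<close>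

text \<open>Scalars can be absorbed into \<phi>, so closing under sums already produces the complex
  linear span of the products. Statements linear in the function can be proved by induction.\<close>

inductive sesquiholomorphic :: "(complex ^ 'n \<Rightarrow> complex) \<Rightarrow> bool" where
  prod: "\<phi> cn_holomorphic_on UNIV \<Longrightarrow> \<psi> cn_holomorphic_on UNIV \<Longrightarrow>
    sesquiholomorphic (\<lambda>z. \<phi> z * cnj (\<psi> z))"
| add: "sesquiholomorphic F \<Longrightarrow> sesquiholomorphic G \<Longrightarrow> sesquiholomorphic (\<lambda>z. F z + G z)"

text \<open>Two generators multiply to a generator, by pairing the holomorphic factors with each
  other and the conjugated ones with each other. Distributivity does the rest, in one induction for
  each argument.\<close>

lemma sesquiholomorphic_mult:
  assumes "sesquiholomorphic F" and "sesquiholomorphic G"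
  shows "sesquiholomorphic (\<lambda>z. F z * G z)"
  using assms(1)
proof induction
  case (prod \<phi> \<psi>)
  from assms(2) show ?case
  proof induction
    case (prod \<phi>' \<psi>')
    have "sesquiholomorphic (\<lambda>z. (\<phi> z * \<phi>' z) * cnj (\<psi> z * \<psi>' z))"
      by (intro sesquiholomorphic.prod cn_holomorphic_on_mult prod
          \<open>\<phi> cn_holomorphic_on UNIV\<close> \<open>\<psi> cn_holomorphic_on UNIV\<close>)
    then show ?case by (simp add: mult_ac)
  next
    case (add F G)
    from sesquiholomorphic.add[OF this(3,4)] show ?case by (simp add: distrib_left)
  qed
next
  case (add F F')
  from sesquiholomorphic.add[OF this(3,4)] show ?case by (simp add: distrib_right)
qed

text \<open>A real linear functional \<open>f\<close> is the real part of the complex linear \<open>f v - \<i> f (\<i> v)\<close>.\<close>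

lemma sesquiholomorphic_real_linear:
  fixes f :: "complex ^ 'n \<Rightarrow> real"
  assumes "bounded_linear f"
  shows "sesquiholomorphic (\<lambda>z. of_real (f z))"
proof -
  interpret bounded_linear f by fact
  \<comment> \<open>The factor 1/2 makes the sum of \<open>L\<close> and its conjugate equal to
    \<open>f\<close>.\<close>
  define L where "L v = (of_real (f v) - \<i> * of_real (f (\<i> *s v))) / 2" for v
  have "bounded_linear L"
    unfolding L_def divide_inverse
    by (intro bounded_linear_intros bounded_linear_compose[OF assms] assms
        bounded_linear_compose[OF bounded_linear_of_real]
        bounded_linear_vector_smult_right)
  moreover have "L (c *s v) = c * L v" for c v
  proof -
    have "c *s v = Re c *\<^sub>R v + Im c *\<^sub>R (\<i> *s v)"
      by (auto simp: vec_eq_iff complex_eq_iff)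
    then have "f (c *s v) = Re c * f v + Im c * f (\<i> *s v)"
      by (simp only: add scaleR real_scaleR_def)
    moreover have "\<i> *s (c *s v) = Re c *\<^sub>R (\<i> *s v) + (- Im c) *\<^sub>R v"
      by (auto simp: vec_eq_iff complex_eq_iff)
    then have "f (\<i> *s (c *s v)) = Re c * f (\<i> *s v) + (- Im c) * f v"
      by (simp only: add scaleR real_scaleR_def)
    ultimately show ?thesis
      by (simp only: L_def) (simp add: complex_eq_iff field_simps)
  qed
  ultimately have "L cn_holomorphic_on UNIV"
    by (rule cn_holomorphic_on_linear)
  then have "sesquiholomorphic (\<lambda>z. L z * cnj 1 + 1 * cnj (L z))"
    by (intro sesquiholomorphic.intros cn_holomorphic_on_const)
  moreover have "(\<lambda>z. L z * cnj 1 + 1 * cnj (L z)) = (\<lambda>z. of_real (f z))"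
    by (auto simp: L_def complex_eq_iff)
  ultimately show ?thesis by simp
qed

lemma sesquiholomorphic_real_polynomial:
  fixes p :: "complex ^ 'n \<Rightarrow> real"
  assumes "real_polynomial_function p"
  shows "sesquiholomorphic (\<lambda>z. of_real (p z))"
  using assms
proof induction
  case (linear f)
  then show ?case by (rule sesquiholomorphic_real_linear)
next
  case (const c)
  show ?case
    using sesquiholomorphic.prod[OF cn_holomorphic_on_const cn_holomorphic_on_const,
        of "of_real c" 1] by simp
next
  case (add f g)
  then show ?case using sesquiholomorphic.add by simp
next
  case (mult f g)
  then show ?case using sesquiholomorphic_mult by simp
qed

section \<open>Weights that annihilate the squared moduli of entire functions\<close>

lemma polarization:
  fixes a b :: complex
  shows "a * cnj b = (of_real ((cmod (a + b))\<^sup>2) + (-1) * of_real ((cmod (a + (-1) * b))\<^sup>2)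
    + \<i> * of_real ((cmod (a + \<i> * b))\<^sup>2) + (-\<i>) * of_real ((cmod (a + (-\<i>) * b))\<^sup>2)) / 4"
  unfolding complex_norm_square by (simp add: algebra_simps)

text \<open>Polarization writes a generator as a combination of squared moduli of the entire
  functions \<open>\<phi> + c \<psi>\<close> with \<open>c\<close> a fourth root of unity.
  Integrability is carried along because additivity of the integral depends on it.\<close>

lemma sesquiholomorphic_integral_zero:
  fixes W :: "complex ^ 'n \<Rightarrow> real"
  assumes W: "\<And>\<phi>. \<phi> cn_holomorphic_on UNIV \<Longrightarrow>
      integrable lborel (\<lambda>z. (cmod (\<phi> z))\<^sup>2 * W z) \<and> (LINT z|lborel. (cmod (\<phi> z))\<^sup>2 * W z) = 0"
    and "sesquiholomorphic F"
  shows "integrable lborel (\<lambda>z. F z * of_real (W z)) \<and>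
    (LINT z|lborel. F z * of_real (W z)) = 0"
  using assms(2)
proof induction
  case (prod \<phi> \<psi>)
  define I where "I c z = complex_of_real ((cmod (\<phi> z + c * \<psi> z))\<^sup>2 * W z)" for c z
  have I: "integrable lborel (I c)" "(LINT z|lborel. I c z) = 0" for c
  proof -
    have "(\<lambda>z. \<phi> z + c * \<psi> z) cn_holomorphic_on UNIV"
      by (intro cn_holomorphic_on_add cn_holomorphic_on_mult cn_holomorphic_on_const prod)
    from W[OF this] show "integrable lborel (I c)" "(LINT z|lborel. I c z) = 0"
      unfolding I_def by (auto simp del: of_real_mult of_real_power)
  qed
  have eq: "(\<lambda>z. \<phi> z * cnj (\<psi> z) * of_real (W z))
      = (\<lambda>z. (I 1 z - I (-1) z + \<i> * I \<i> z - \<i> * I (-\<i>) z) / 4)"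
    by (subst polarization) (simp add: I_def algebra_simps)
  show ?case
    unfolding eq using I by simp
next
  case (add F G)
  then show ?case by (simp add: distrib_right)
qed

text \<open>Real polynomials integrate to zero against \<open>W\<close> and approximate
  \<open>p\<close> uniformly on \<open>K\<close>, which carries \<open>W\<close>. The integral of
  \<open>p W\<close> is therefore at most \<open>e\<close> times the integral of the modulus of
  \<open>W\<close>, for every positive \<open>e\<close>.\<close>

lemma continuous_integral_zero:
  fixes W p :: "complex ^ 'n \<Rightarrow> real"
  assumes W: "\<And>\<phi>. \<phi> cn_holomorphic_on UNIV \<Longrightarrow>
      integrable lborel (\<lambda>z. (cmod (\<phi> z))\<^sup>2 * W z) \<and> (LINT z|lborel. (cmod (\<phi> z))\<^sup>2 * W z) = 0"
    and "compact K" and out: "\<And>z. z \<notin> K \<Longrightarrow> W z = 0"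
    and p: "continuous_on UNIV p" "\<And>z. \<bar>p z\<bar> \<le> B"
  shows "integrable lborel (\<lambda>z. p z * W z) \<and> (LINT z|lborel. p z * W z) = 0"
proof -
  \<comment> \<open>The constant function 1 is entire.\<close>
  have iW: "integrable lborel W"
    using W[OF cn_holomorphic_on_const[of 1]] by simp
  have ipW: "integrable lborel (\<lambda>z. p z * W z)"
  proof (rule Bochner_Integration.integrable_bound)
    show "integrable lborel (\<lambda>z. B * W z)" using iW by simp
    show "(\<lambda>z. p z * W z) \<in> borel_measurable lborel"
      using borel_measurable_integrable[OF iW] borel_measurable_continuous_onI[OF p(1)] by simp
    show "AE z in lborel. norm (p z * W z) \<le> norm (B * W z)"
      using p(2) by (auto simp: abs_mult intro!: mult_right_mono order_trans[OF p(2)])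
  qed
  have bound: "\<bar>LINT z|lborel. p z * W z\<bar> \<le> e * (LINT z|lborel. \<bar>W z\<bar>)" if "e > 0" for e
  proof -
    obtain q where q: "real_polynomial_function q" "\<And>z. z \<in> K \<Longrightarrow> \<bar>p z - q z\<bar> < e"
      using Stone_Weierstrass_real_polynomial_function[OF \<open>compact K\<close> _ \<open>e > 0\<close>]
        continuous_on_subset[OF p(1)] by (metis subset_UNIV)
    have "integrable lborel (\<lambda>z. complex_of_real (q z * W z)) \<and>
        (LINT z|lborel. complex_of_real (q z * W z)) = 0"
      using sesquiholomorphic_integral_zero[OF W sesquiholomorphic_real_polynomial[OF q(1)]]
      by simp
    then have qW: "integrable lborel (\<lambda>z. q z * W z)" "(LINT z|lborel. q z * W z) = 0"
      using integrable_Re[of lborel "\<lambda>z. complex_of_real (q z * W z)"]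
      by (auto simp del: of_real_mult)
    have "(LINT z|lborel. p z * W z) = (LINT z|lborel. (p z - q z) * W z)"
      using ipW qW by (simp add: left_diff_distrib)
    also have "norm \<dots> \<le> (LINT z|lborel. e * \<bar>W z\<bar>)"
    proof (rule Bochner_Integration.integral_norm_bound_integral)
      show "integrable lborel (\<lambda>z. (p z - q z) * W z)"
        using ipW qW by (simp add: left_diff_distrib)
      show "integrable lborel (\<lambda>z. e * \<bar>W z\<bar>)" using iW by simp
      \<comment> \<open>The polynomial is uncontrolled off \<open>K\<close>, but there
        \<open>W\<close> vanishes.\<close>
      show "norm ((p z - q z) * W z) \<le> e * \<bar>W z\<bar>" for z
        using q(2)[of z] out[of z]
        by (cases "z \<in> K") (auto simp: abs_mult intro!: mult_right_mono)
    qed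
    finally show ?thesis by simp
  qed
  have "(LINT z|lborel. p z * W z) = 0"
  proof (rule ccontr)
    define M where "M = (LINT z|lborel. \<bar>W z\<bar>)"
    define J where "J = \<bar>LINT z|lborel. p z * W z\<bar>"
    assume "(LINT z|lborel. p z * W z) \<noteq> 0"
    then have "J > 0" by (simp add: J_def)
    have "M \<ge> 0" by (simp add: M_def)
    \<comment> \<open>With this choice of \<open>e\<close> the bound reads
      \<open>J \<le> J M / (M + 1)\<close>, which is impossible for positive \<open>J\<close>.
      Adding 1 keeps the denominator positive even if \<open>M\<close> is 0.\<close>
    have "J / (M + 1) > 0"
      using \<open>J > 0\<close> \<open>M \<ge> 0\<close> by (intro divide_pos_pos) auto
    from bound[OF this] have "J \<le> J / (M + 1) * M"
      by (simp only: J_def M_def)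
    then have "J * (M + 1) \<le> J * M"
      using \<open>M \<ge> 0\<close> by (simp add: pos_le_divide_eq)
    then show False
      using \<open>J > 0\<close> by (simp add: distrib_left)
  qed
  with ipW show ?thesis by blast
qed

text \<open>If \<open>W\<close> were positive at a point, it would be positive on a ball, and
  integrating it against a bump supported there could not give zero. The one-sided form can be
  applied to a weight and to its negative.\<close>

lemma weight_nonpos:
  fixes W :: "complex ^ 'n \<Rightarrow> real"
  assumes W: "\<And>\<phi>. \<phi> cn_holomorphic_on UNIV \<Longrightarrow>
      integrable lborel (\<lambda>z. (cmod (\<phi> z))\<^sup>2 * W z) \<and> (LINT z|lborel. (cmod (\<phi> z))\<^sup>2 * W z) = 0"
    and "open \<Omega>" and "bounded \<Omega>" and out: "\<And>z. z \<notin> \<Omega> \<Longrightarrow> W z = 0"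
    and cont: "continuous_on \<Omega> W"
  shows "W z \<le> 0"
proof (rule ccontr)
  assume "\<not> W z \<le> 0"
  then have z: "z \<in> {z \<in> \<Omega>. W z > 0}" using out by force
  have "open {z \<in> \<Omega>. W z > 0}"
    using continuous_open_preimage[OF cont \<open>open \<Omega>\<close>, of "{0<..}"]
    by (simp add: vimage_def Int_def)
  with z obtain e where e: "e > 0" "ball z e \<subseteq> {z \<in> \<Omega>. W z > 0}"
    unfolding open_contains_ball by blast
  \<comment> \<open>A tent function: continuous on the whole space, bounded by \<open>e\<close>,
    positive exactly on the ball.\<close>
  define p where "p w = max 0 (e - dist z w)" for w
  have "integrable lborel (\<lambda>z. p z * W z) \<and> (LINT z|lborel. p z * W z) = 0"
  proof (rule continuous_integral_zero[OF W])
    show "compact (closure \<Omega>)" using \<open>bounded \<Omega>\<close> by simp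
    show "W z = 0" if "z \<notin> closure \<Omega>" for z
      using out that closure_subset by blast
    show "continuous_on UNIV p"
      unfolding p_def by (intro continuous_intros)
    show "\<bar>p w\<bar> \<le> e" for w using e by (simp add: p_def)
  qed
  moreover have "0 \<le> p w * W w" for w
  proof (cases "w \<in> ball z e")
    case True
    then have "W w > 0" using e by blast
    then show ?thesis by (simp add: p_def)
  qed (simp add: p_def)
  ultimately have "AE w in lborel. p w * W w = 0"
    using integral_nonneg_eq_0_iff_AE[of lborel "\<lambda>w. p w * W w"] by simp
  \<comment> \<open>Both factors are positive on the ball, so the almost everywhere vanishing of
    their product makes the ball a null set.\<close>
  then have "AE w in lborel. w \<notin> ball z e"
  proof eventually_elim
    case (elim w)
    show ?case
    proof
      assume "w \<in> ball z e"
      moreover then have "W w > 0" using e by blast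
      ultimately show False using elim by (simp add: p_def)
    qed
  qed
  then have "ball z e \<in> null_sets lborel"
    by (subst AE_iff_null_sets) auto
  then have "negligible (ball z e)"
    by (simp add: negligible_iff_null_sets null_sets_completionI)
  then show False
    using e open_not_negligible[of "ball z e"] by simp
qed

section \<open>Isometric module maps\<close>

text \<open>The cut-off matches the convention that elements of \<open>domain_algebra\<close> vanish
  off the closure. The constant sequence \<phi> serves as the holomorphic approximation.\<close>

lemma domain_algebra_restrict_entire:
  assumes "\<phi> cn_holomorphic_on UNIV"
  shows "(\<lambda>z. if z \<in> closure \<Omega> then \<phi> z else 0) \<in> domain_algebra \<Omega>"
proof -
  have "continuous_on (closure \<Omega>) \<phi>"
    using cn_holomorphic_on_imp_continuous_on[OF assms] continuous_on_subset by blast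
  then have "continuous_on (closure \<Omega>) (\<lambda>z. if z \<in> closure \<Omega> then \<phi> z else 0)"
    by (subst continuous_on_cong[OF refl]) auto
  moreover have "uniform_limit (closure \<Omega>) (\<lambda>k::nat. \<phi>)
      (\<lambda>z. if z \<in> closure \<Omega> then \<phi> z else 0) sequentially"
    by (auto simp: uniform_limit_iff)
  ultimately show ?thesis
    unfolding domain_algebra_def using assms
    by (intro CollectI conjI exI[of _ "\<lambda>k. \<phi>"]) auto
qed

lemma bergman_space_integrable:
  assumes "f \<in> bergman_space \<Omega>"
  shows "integrable lborel (\<lambda>z. (cmod (f z))\<^sup>2)"
    and "bergman_norm \<Omega> f = sqrt (LINT z|lborel. (cmod (f z))\<^sup>2)"
proof -
  have "(\<lambda>z. indicator \<Omega> z *\<^sub>R (cmod (f z))\<^sup>2) = (\<lambda>z. (cmod (f z))\<^sup>2)"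
    using assms by (auto simp: bergman_space_def indicator_def fun_eq_iff)
  then show "integrable lborel (\<lambda>z. (cmod (f z))\<^sup>2)"
    and "bergman_norm \<Omega> f = sqrt (LINT z|lborel. (cmod (f z))\<^sup>2)"
    using assms by (auto simp: bergman_space_def set_integrable_def bergman_norm_def
        set_lebesgue_integral_def)
qed

text \<open>Equality of the norms of all multiples says that the difference \<open>W\<close> of the
  squared moduli integrates to zero against every squared modulus of an entire function. Hence
  neither \<open>W\<close> nor its negative is positive anywhere.\<close>

lemma norm_eq_if_multiples_norm_eq:
  assumes "open \<Omega>" and "bounded \<Omega>"
    and f: "f \<in> bergman_space \<Omega>" and g: "g \<in> bergman_space \<Omega>"
    and mem: "\<And>\<phi>. \<phi> \<in> domain_algebra \<Omega> \<Longrightarrow>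
      (\<lambda>z. \<phi> z * f z) \<in> bergman_space \<Omega> \<and> (\<lambda>z. \<phi> z * g z) \<in> bergman_space \<Omega>"
    and norm: "\<And>\<phi>. \<phi> \<in> domain_algebra \<Omega> \<Longrightarrow>
      bergman_norm \<Omega> (\<lambda>z. \<phi> z * f z) = bergman_norm \<Omega> (\<lambda>z. \<phi> z * g z)"
  shows "cmod (f z) = cmod (g z)"
proof -
  define W where "W z = (cmod (f z))\<^sup>2 - (cmod (g z))\<^sup>2" for z
  have out: "f z = 0" "g z = 0" if "z \<notin> \<Omega>" for z
    using f g that by (auto simp: bergman_space_def)
  have W: "integrable lborel (\<lambda>z. (cmod (\<phi> z))\<^sup>2 * W z)"
    "(LINT z|lborel. (cmod (\<phi> z))\<^sup>2 * W z) = 0" if "\<phi> cn_holomorphic_on UNIV" for \<phi>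
  proof -
    define \<psi> where "\<psi> = (\<lambda>z. if z \<in> closure \<Omega> then \<phi> z else 0)"
    have \<psi>: "\<psi> \<in> domain_algebra \<Omega>"
      unfolding \<psi>_def by (rule domain_algebra_restrict_entire[OF that])
    note m = mem[OF \<psi>, THEN conjunct1] mem[OF \<psi>, THEN conjunct2]
    \<comment> \<open>The cut-off \<psi> agrees with \<phi> on \<Omega>, and off \<Omega> both
      \<open>f\<close> and \<open>g\<close> vanish.\<close>
    have "(cmod (\<phi> z))\<^sup>2 * W z = (cmod (\<psi> z * f z))\<^sup>2 - (cmod (\<psi> z * g z))\<^sup>2" for z
      using out[of z] closure_subset[of \<Omega>]
      by (cases "z \<in> \<Omega>") (auto simp: \<psi>_def W_def norm_mult power_mult_distrib right_diff_distrib)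
    moreover have "(LINT z|lborel. (cmod (\<psi> z * f z))\<^sup>2) = (LINT z|lborel. (cmod (\<psi> z * g z))\<^sup>2)"
      using norm[OF \<psi>] bergman_space_integrable(2)[OF m(1)] bergman_space_integrable(2)[OF m(2)]
      by simp
    ultimately show "integrable lborel (\<lambda>z. (cmod (\<phi> z))\<^sup>2 * W z)"
      "(LINT z|lborel. (cmod (\<phi> z))\<^sup>2 * W z) = 0"
      using bergman_space_integrable(1)[OF m(1)] bergman_space_integrable(1)[OF m(2)]
      by simp_all
  qed
  have cont: "continuous_on \<Omega> W"
    unfolding W_def using f g
    by (intro continuous_intros cn_holomorphic_on_imp_continuous_on) (auto simp: bergman_space_def)
  have "W z \<le> 0"
    by (rule weight_nonpos[OF _ assms(1,2) _ cont]) (simp add: W, simp add: W_def out)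
  moreover have "- W z \<le> 0"
    by (rule weight_nonpos[OF _ assms(1,2) _ continuous_on_minus[OF cont]])
      (simp_all add: W, simp add: W_def out)
  ultimately have "W z = 0" by simp
  then show ?thesis by (simp add: W_def)
qed

theorem corollary8p5:
  fixes \<Omega> :: "(complex ^ 'n) set"
    and S1 S2 :: "(complex ^ 'n \<Rightarrow> complex) set"
  assumes "open \<Omega>" and "connected \<Omega>" and "\<Omega> \<noteq> {}" and "bounded \<Omega>"
    and "bergman_submodule \<Omega> S1" and "bergman_submodule \<Omega> S2"
    and "isometrically_isomorphic \<Omega> S1 S2"
  shows "S1 = S2"
proof -
  obtain T where T: "T ` S1 = S2"
    "\<And>f. f \<in> S1 \<Longrightarrow> bergman_norm \<Omega> (T f) = bergman_norm \<Omega> f"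
    "\<And>\<phi> f. \<phi> \<in> domain_algebra \<Omega> \<Longrightarrow> f \<in> S1 \<Longrightarrow> T (\<lambda>z. \<phi> z * f z) = (\<lambda>z. \<phi> z * T f z)"
    using assms(7) unfolding isometrically_isomorphic_def by blast
  have sub: "S1 \<subseteq> bergman_space \<Omega>" "S2 \<subseteq> bergman_space \<Omega>"
    and scale: "\<And>c f. f \<in> S1 \<Longrightarrow> (\<lambda>z. c * f z) \<in> S1" "\<And>c f. f \<in> S2 \<Longrightarrow> (\<lambda>z. c * f z) \<in> S2"
    and mult: "\<And>\<phi> f. \<phi> \<in> domain_algebra \<Omega> \<Longrightarrow> f \<in> S1 \<Longrightarrow> (\<lambda>z. \<phi> z * f z) \<in> S1"
      "\<And>\<phi> f. \<phi> \<in> domain_algebra \<Omega> \<Longrightarrow> f \<in> S2 \<Longrightarrow> (\<lambda>z. \<phi> z * f z) \<in> S2"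
    using assms(5,6) unfolding bergman_submodule_def by simp_all
  \<comment> \<open>The scalar may depend on \<open>f\<close>: invariance of each submodule under
    all scalars is enough to conclude.\<close>
  have key: "\<exists>c. cmod c = 1 \<and> T f = (\<lambda>z. c * f z)" if f: "f \<in> S1" for f
  proof -
    have Tf: "T f \<in> S2" using T(1) f by blast
    have "bergman_norm \<Omega> (\<lambda>z. \<phi> z * T f z) = bergman_norm \<Omega> (\<lambda>z. \<phi> z * f z)"
      if "\<phi> \<in> domain_algebra \<Omega>" for \<phi>
      \<comment> \<open>The isometry is applied to \<open>\<phi> f\<close>, which lies in
        \<open>S1\<close>, and \<phi> is then pulled out of \<open>T\<close>.\<close>
      using T(2)[OF mult(1)[OF that f]] T(3)[OF that f] by simp
    then have eq: "cmod (T f z) = cmod (f z)" for z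
    proof (intro norm_eq_if_multiples_norm_eq[OF assms(1,4)])
      show "T f \<in> bergman_space \<Omega>" "f \<in> bergman_space \<Omega>"
        using f Tf sub by auto
      show "(\<lambda>z. \<phi> z * T f z) \<in> bergman_space \<Omega> \<and> (\<lambda>z. \<phi> z * f z) \<in> bergman_space \<Omega>"
        if "\<phi> \<in> domain_algebra \<Omega>" for \<phi>
        using mult(1)[OF that f] mult(2)[OF that Tf] sub by auto
    qed
    have hol: "f cn_holomorphic_on \<Omega>" "T f cn_holomorphic_on \<Omega>" "\<And>z. z \<notin> \<Omega> \<Longrightarrow> f z = 0"
      using sub f Tf by (auto simp: bergman_space_def)
    obtain c where c: "cmod c = 1" "\<And>z. z \<in> \<Omega> \<Longrightarrow> T f z = c * f z"
      using cn_holomorphic_equal_norm_imp_proportional[OF hol(1,2) assms(1,2) eq] by blast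
    \<comment> \<open>Off \<Omega> both sides are 0, as the equality of moduli holds there
      too.\<close>
    have "T f z = c * f z" for z
      using c(2)[of z] hol(3)[of z] eq[of z] by (cases "z \<in> \<Omega>") auto
    with c(1) show ?thesis by blast
  qed
  show ?thesis
  proof
    show "S1 \<subseteq> S2"
    proof
      fix f assume f: "f \<in> S1"
      with key obtain c where c: "cmod c = 1" "T f = (\<lambda>z. c * f z)" by blast
      have "c \<noteq> 0" using c(1) by auto
      then have "f = (\<lambda>z. inverse c * T f z)" by (simp add: c(2) fun_eq_iff)
      then show "f \<in> S2" using scale(2)[of "T f" "inverse c"] T(1) f by auto
    qed
    show "S2 \<subseteq> S1"
    proof
      fix g assume "g \<in> S2"
      then obtain f where "f \<in> S1" "g = T f" using T(1) by blast
      with key scale(1) show "g \<in> S1" by metis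
    qed
  qed
qed

end
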